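(* The algorithm FAIR_K_CLUSTER described in the context is a $5$-approximation to the fair $k$-center clustering problem, and a $3$-approximation when $F=C$.
   Context: **Fair $k$-center clustering problem.** $C$ is a set of $N$ points (clients) in a metric space $(\mathcal X,d)$ and $F\subset\mathcal X$ is a set of potential cluster centers. We are given $l$ protected groups $C_1,\dots,C_l$ (not necessarily disjoint) such that each point of $C$ belongs to at least one group, and vectors $\alpha,\beta\in\mathbb R^l$ with $\alpha_i\ge\beta_i$. The problem is to find $S\subset F$ with $|S|=k$ and a map $\phi:C\to S$ minimizing $\max_{v\in C}d(v,\phi(v))$ subject to, for all $f\in S$ and all $i\in[l]=\{1,\dots,l\}$, $$\beta_i\,|\{v\in C:\phi(v)=f\}|\ \le\ |\{v\in C_i:\phi(v)=f\}|\ \le\ \alpha_i\,|\{v\in C:\phi(v)=f\}|.$$ Its optimal value is denoted $\lambda^*_\alpha$. **Meaning of approximation.** The algorithm is a $c$-approximation if the $k$-center cost (radius) it achieves is at most $c\,\lambda^*_\alpha$. The clustering is obtained from the solution of a linear program by the randomized assignment below; it need not satisfy the fairness constraints exactly, but respects them in expectation. **Notation.** $d(x,S)=\min_{y\in S}d(x,y)$, and $B(x,\lambda)$ is the closed ball with center $x$ and radius $\lambda$. For nonempty $S'\subset S$, the joiner is $J_{S',\lambda}=\bigcap_{x\in S'}B(x,\lambda)\cap\bigcap_{x\in S\setminus S'}\overline{B(x,\lambda)}$, where the bar denotes complement. The signature $Sig(x)$ of $x\in C$ is the increasing tuple of the indices of all groups containing $x$; $I$ is the set of all signatures; $a\in c$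 means that the index $a$ occurs in the signature $c$. Put $L(c,S',\lambda)=\{x\in C:\ x\in J_{S',\lambda},\ Sig(x)=c\}$. **Frequency-distributor linear program for $(C,S,k,\alpha,\beta,\lambda)$.** There is a variable $x_{c,S',j}$ for each $c\in I$, nonempty $S'\subset S$ and $j\in S'$ with $|L(c,S',\lambda)|>0$. The objective is the constant $1$ (only feasibility matters), and the constraints are: (1) for all $a\in[l]$, $j\in S$: $\ \beta_a\sum_{c\in I,\,S'\ni j}x_{c,S',j}\le\sum_{S'\ni j,\ c\in I:\,a\in c}x_{c,S',j}\le\alpha_a\sum_{c\in I,\,S'\ni j}x_{c,S',j}$; (2) for all $c,S'$ with $|L(c,S',\lambda)|>0$: $\ \sum_{j\in S'}x_{c,S',j}=|L(c,S',\lambda)|$; (3) $x_{c,S',j}\ge0$. **Algorithm FAIR_K_CLUSTER$(C,F,k,\alpha,\beta,\epsilon)$.** 1. $S\leftarrow$ greedy_k_center$(F,k)$, i.e. run the greedy $k$-center algorithm for the classical $k$-center problem (minimize $\max_{v\in C}d(v,\phi(v))$ over $S\subset F$, $|S|=k$, $\phi:C\to S$, with no fairness constraints) to get $k$ centers $S\subset F$. The greedy algorithm successively chooses $k$ clients $U$, each new client being the furthest from the centers chosen so far, and the corresponding centers are $S=\{\sigma(u):u\in U\}$, where $\sigma(u)$ is the closest center from $F$ to $u$ (so $\sigma(u)=u$ if $F=C$). 2. Compute the matrix of distances between $C$ and $S$. Set $\ell=0$, $r=2\cdot$(the maximum entry of this matrix), and feasible $=$ False. 3. While $r-\ell>\epsilon$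 or not feasible: set $\lambda=(\ell+r)/2$. If some $x\in C$ has $d(x,S)>\lambda$, set $\ell=\lambda$, feasible $=$ False, and continue with the next iteration. Otherwise form the frequency-distributor linear program for $(C,S,k,\alpha,\beta,\lambda)$; if it has a feasible solution, set $r=\lambda$, feasible $=$ True; else set $\ell=\lambda$, feasible $=$ False. 4. Return $\lambda$. **Randomized assignment.** Given a feasible LP solution at radius $\lambda$, each $x\in L(c,S',\lambda)$ is independently assigned to center $j\in S'$ with probability $x_{c,S',j}/|L(c,S',\lambda)|$. Each client is thus assigned to a center at distance at most $\lambda$, and the fairness constraints hold in expectation.
   Formalization: Literal bound fails due to search tolerance: proved radius at most c·λ*+ε for every ε>0, and cost of the assignment at most c·λ* for all small enough ε; if the while loop never stops, the limit of the successive λ is taken; a feasible fair clustering is assumed to exist. *)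

theory Defs
  imports "HOL-Probability.Probability" "HOL-Library.While_Combinator"
begin

section \<open>The fair k-center problem\<close>

text \<open>The protected groups are \<open>G 1, \<dots>, G l\<close>.  The ambient metric space is the type \<open>'a\<close>.\<close>

definition cluster_cost :: "'a::metric_space set \<Rightarrow> ('a \<Rightarrow> 'a) \<Rightarrow> real" where
  "cluster_cost C \<phi> = Max ((\<lambda>v. dist v (\<phi> v)) ` C)"

definition fair_clustering ::
  "'a::metric_space set \<Rightarrow> 'a set \<Rightarrow> nat \<Rightarrow> (nat \<Rightarrow> 'a set) \<Rightarrow> nat \<Rightarrow> (nat \<Rightarrow> real) \<Rightarrow> (nat \<Rightarrow> real)
    \<Rightarrow> 'a set \<Rightarrow> ('a \<Rightarrow> 'a) \<Rightarrow> bool" where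
  "fair_clustering C F l G k \<alpha> \<beta> S \<phi> \<longleftrightarrow>
     S \<subseteq> F \<and> finite S \<and> card S = k \<and> \<phi> ` C \<subseteq> S \<and>
     (\<forall>f\<in>S. \<forall>i\<in>{1..l}.
        \<beta> i * real (card {v \<in> C. \<phi> v = f}) \<le> real (card {v \<in> G i. \<phi> v = f}) \<and>
        real (card {v \<in> G i. \<phi> v = f}) \<le> \<alpha> i * real (card {v \<in> C. \<phi> v = f}))"

definition fair_opt ::
  "'a::metric_space set \<Rightarrow> 'a set \<Rightarrow> nat \<Rightarrow> (nat \<Rightarrow> 'a set) \<Rightarrow> nat \<Rightarrow> (nat \<Rightarrow> real) \<Rightarrow> (nat \<Rightarrow> real)
    \<Rightarrow> real" where
  "fair_opt C F l G k \<alpha> \<beta> = Inf {cluster_cost C \<phi> | S \<phi>. fair_clustering C F l G k \<alpha> \<beta> S \<phi>}"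


section \<open>The greedy algorithm\<close>

text \<open>\<open>greedy_k_center C F k S\<close> means that \<open>S\<close> is a possible output of the greedy algorithm; the
  first client and all ties are arbitrary, and \<open>us\<close> lists the chosen clients in order.  Several
  clients may share a closest center, so \<open>S\<close> can have fewer than \<open>k\<close> elements.  A client is only
  compared with the clients not chosen before: when \<open>F \<noteq> C\<close>, a client that is already chosen may
  still be the furthest one, and the definition admits both choosing it again and skipping it.\<close>

definition greedy_k_center :: "'a::metric_space set \<Rightarrow> 'a set \<Rightarrow> nat \<Rightarrow> 'a set \<Rightarrow> bool" where
  "greedy_k_center C F k S \<longleftrightarrow>
     (\<exists>us \<sigma>. (\<forall>u\<in>C. \<sigma> u \<in> F \<and> (\<forall>f\<in>F. dist u (\<sigma> u) \<le> dist u f)) \<and>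
        length us = k \<and> set us \<subseteq> C \<and>
        (\<forall>i<k. \<forall>v\<in>C - set (take i us).
           infdist v (\<sigma> ` set (take i us)) \<le> infdist (us ! i) (\<sigma> ` set (take i us))) \<and>
        S = \<sigma> ` set us)"

lemma greedy_k_center_exists:
  assumes C: "finite C" "C \<noteq> {}" and F: "finite F" "F \<noteq> {}"
  shows "\<exists>S. greedy_k_center C F k S"
proof -
  define \<sigma> where "\<sigma> u = arg_min_on (dist u) F" for u
  have \<sigma>: "\<sigma> u \<in> F \<and> (\<forall>f\<in>F. dist u (\<sigma> u) \<le> dist u f)" for u
    unfolding \<sigma>_def using arg_min_if_finite[OF F, of "dist u"] by (auto simp: not_less)
  have "\<exists>us. length us = k \<and> set us \<subseteq> C \<and>
        (\<forall>i<k. \<forall>v\<in>C - set (take i us).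
           infdist v (\<sigma> ` set (take i us)) \<le> infdist (us ! i) (\<sigma> ` set (take i us)))"
  proof (induction k)
    case 0
    then show ?case by simp
  next
    case (Suc k)
    then obtain us where us: "length us = k" "set us \<subseteq> C"
      "\<And>i v. i < k \<Longrightarrow> v \<in> C - set (take i us) \<Longrightarrow>
         infdist v (\<sigma> ` set (take i us)) \<le> infdist (us ! i) (\<sigma> ` set (take i us))"
      by blast
    obtain u where u: "u \<in> C" "\<And>v. v \<in> C \<Longrightarrow> infdist v (\<sigma> ` set us) \<le> infdist u (\<sigma> ` set us)"
      using ex_is_arg_min_if_finite[OF C, of "\<lambda>v. - infdist v (\<sigma> ` set us)"]
      by (auto simp: is_arg_min_def not_less)
    show ?case
      using us u by (intro exI[of _ "us @ [u]"]) (auto simp: less_Suc_eq nth_append)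
  qed
  with \<sigma> show ?thesis unfolding greedy_k_center_def by blast
qed


section \<open>The frequency-distributor linear program\<close>

definition joiner :: "'a::metric_space set \<Rightarrow> 'a set \<Rightarrow> real \<Rightarrow> 'a set" where
  "joiner S S' \<rho> = (\<Inter>x\<in>S'. cball x \<rho>) \<inter> (\<Inter>x\<in>S - S'. - cball x \<rho>)"

definition signature :: "nat \<Rightarrow> (nat \<Rightarrow> 'a set) \<Rightarrow> 'a \<Rightarrow> nat list" where
  "signature l G x = sorted_list_of_set {i \<in> {1..l}. x \<in> G i}"

definition cell ::
  "'a::metric_space set \<Rightarrow> nat \<Rightarrow> (nat \<Rightarrow> 'a set) \<Rightarrow> 'a set \<Rightarrow> nat list \<Rightarrow> 'a set \<Rightarrow> real \<Rightarrow> 'a set" where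
  "cell C l G S c S' \<rho> = {x \<in> C. x \<in> joiner S S' \<rho> \<and> signature l G x = c}"

definition lp_cells ::
  "'a::metric_space set \<Rightarrow> nat \<Rightarrow> (nat \<Rightarrow> 'a set) \<Rightarrow> 'a set \<Rightarrow> real \<Rightarrow> (nat list \<times> 'a set) set" where
  "lp_cells C l G S \<rho> =
     {(c, S'). c \<in> signature l G ` C \<and> S' \<noteq> {} \<and> S' \<subseteq> S \<and> card (cell C l G S c S' \<rho>) > 0}"

text \<open>The variables of the program are the values \<open>X c S' j\<close> with \<open>(c, S') \<in> lp_cells C l G S \<rho>\<close>
  and \<open>j \<in> S'\<close>; all other values of \<open>X\<close> are irrelevant.\<close>

definition lp_solution ::
  "'a::metric_space set \<Rightarrow> nat \<Rightarrow> (nat \<Rightarrow> 'a set) \<Rightarrow> (nat \<Rightarrow> real) \<Rightarrow> (nat \<Rightarrow> real) \<Rightarrow> 'a set \<Rightarrow> real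
    \<Rightarrow> (nat list \<Rightarrow> 'a set \<Rightarrow> 'a \<Rightarrow> real) \<Rightarrow> bool" where
  "lp_solution C l G \<alpha> \<beta> S \<rho> X \<longleftrightarrow>
     (\<forall>a\<in>{1..l}. \<forall>j\<in>S.
        \<beta> a * (\<Sum>(c, S') \<in> {(c, S') \<in> lp_cells C l G S \<rho>. j \<in> S'}. X c S' j)
          \<le> (\<Sum>(c, S') \<in> {(c, S') \<in> lp_cells C l G S \<rho>. j \<in> S' \<and> a \<in> set c}. X c S' j) \<and>
        (\<Sum>(c, S') \<in> {(c, S') \<in> lp_cells C l G S \<rho>. j \<in> S' \<and> a \<in> set c}. X c S' j)
          \<le> \<alpha> a * (\<Sum>(c, S') \<in> {(c, S') \<in> lp_cells C l G S \<rho>. j \<in> S'}. X c S' j)) \<and>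
     (\<forall>(c, S') \<in> lp_cells C l G S \<rho>. (\<Sum>j\<in>S'. X c S' j) = real (card (cell C l G S c S' \<rho>))) \<and>
     (\<forall>(c, S') \<in> lp_cells C l G S \<rho>. \<forall>j\<in>S'. X c S' j \<ge> 0)"


section \<open>The binary search\<close>

record search_state =
  lower :: real
  upper :: real
  feasible :: bool
  radius :: real

text \<open>The initial value of \<open>radius\<close> is irrelevant, since the loop body runs at least once.\<close>

definition search_init :: "'a::metric_space set \<Rightarrow> 'a set \<Rightarrow> search_state" where
  "search_init C S =
     \<lparr>lower = 0, upper = 2 * Max {dist x f | x f. x \<in> C \<and> f \<in> S}, feasible = False, radius = 0\<rparr>"

definition search_cond :: "real \<Rightarrow> search_state \<Rightarrow> bool" where
  "search_cond \<epsilon> s \<longleftrightarrow> upper s - lower s > \<epsilon> \<or> \<not> feasible s"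

definition search_step ::
  "'a::metric_space set \<Rightarrow> nat \<Rightarrow> (nat \<Rightarrow> 'a set) \<Rightarrow> (nat \<Rightarrow> real) \<Rightarrow> (nat \<Rightarrow> real) \<Rightarrow> 'a set
    \<Rightarrow> search_state \<Rightarrow> search_state" where
  "search_step C l G \<alpha> \<beta> S s =
     (let \<rho> = (lower s + upper s) / 2 in
      if \<exists>x\<in>C. infdist x S > \<rho> then s\<lparr>lower := \<rho>, feasible := False, radius := \<rho>\<rparr>
      else if \<exists>X. lp_solution C l G \<alpha> \<beta> S \<rho> X then s\<lparr>upper := \<rho>, feasible := True, radius := \<rho>\<rparr>
      else s\<lparr>lower := \<rho>, feasible := False, radius := \<rho>\<rparr>)"

text \<open>If a midpoint happens to be exactly the least radius for which the program is feasible while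
  the interval is still longer than \<open>\<epsilon>\<close>, then all later midpoints are infeasible and the loop runs
  forever (for \<open>k = 1\<close> this happens unless \<open>\<epsilon>\<close> is large).  In that case the radius found by the
  search is the limit of the successive radii.\<close>

definition fair_k_cluster_radius ::
  "'a::metric_space set \<Rightarrow> nat \<Rightarrow> (nat \<Rightarrow> 'a set) \<Rightarrow> (nat \<Rightarrow> real) \<Rightarrow> (nat \<Rightarrow> real) \<Rightarrow> real \<Rightarrow> 'a set
    \<Rightarrow> real \<Rightarrow> bool" where
  "fair_k_cluster_radius C l G \<alpha> \<beta> \<epsilon> S \<rho> \<longleftrightarrow>
     (case while_option (search_cond \<epsilon>) (search_step C l G \<alpha> \<beta> S) (search_init C S) of
        Some s \<Rightarrow> \<rho> = radius s
      | None \<Rightarrow> (\<lambda>n. radius ((search_step C l G \<alpha> \<beta> S ^^ n) (search_init C S))) \<longlonglongrightarrow> \<rho>)"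


section \<open>The randomized assignment\<close>

text \<open>The subset \<open>{f \<in> S. v \<in> cball f \<rho>}\<close> is the only \<open>S' \<subseteq> S\<close> with \<open>v \<in> joiner S S' \<rho>\<close>.\<close>

definition center_pmf ::
  "'a::metric_space set \<Rightarrow> nat \<Rightarrow> (nat \<Rightarrow> 'a set) \<Rightarrow> 'a set \<Rightarrow> real \<Rightarrow> (nat list \<Rightarrow> 'a set \<Rightarrow> 'a \<Rightarrow> real)
    \<Rightarrow> 'a \<Rightarrow> 'a pmf" where
  "center_pmf C l G S \<rho> X v =
     (let c = signature l G v; S' = {f \<in> S. v \<in> cball f \<rho>}
      in embed_pmf (\<lambda>j. if j \<in> S' then X c S' j / real (card (cell C l G S c S' \<rho>)) else 0))"

definition randomized_assignment ::
  "'a::metric_space set \<Rightarrow> nat \<Rightarrow> (nat \<Rightarrow> 'a set) \<Rightarrow> 'a set \<Rightarrow> real \<Rightarrow> (nat list \<Rightarrow> 'a set \<Rightarrow> 'a \<Rightarrow> real)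
    \<Rightarrow> ('a \<Rightarrow> 'a) pmf" where
  "randomized_assignment C l G S \<rho> X = Pi_pmf C undefined (center_pmf C l G S \<rho> X)"

definition fair_in_expectation ::
  "'a set \<Rightarrow> nat \<Rightarrow> (nat \<Rightarrow> 'a set) \<Rightarrow> (nat \<Rightarrow> real) \<Rightarrow> (nat \<Rightarrow> real) \<Rightarrow> 'a set \<Rightarrow> ('a \<Rightarrow> 'a) pmf
    \<Rightarrow> bool" where
  "fair_in_expectation C l G \<alpha> \<beta> S p \<longleftrightarrow>
     (\<forall>f\<in>S. \<forall>i\<in>{1..l}.
        \<beta> i * measure_pmf.expectation p (\<lambda>\<phi>. real (card {v \<in> C. \<phi> v = f}))
          \<le> measure_pmf.expectation p (\<lambda>\<phi>. real (card {v \<in> G i. \<phi> v = f})) \<and>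
        measure_pmf.expectation p (\<lambda>\<phi>. real (card {v \<in> G i. \<phi> v = f}))
          \<le> \<alpha> i * measure_pmf.expectation p (\<lambda>\<phi>. real (card {v \<in> C. \<phi> v = f})))"


section \<open>Approximation\<close>

text \<open>The search stops with an interval of length at most \<open>\<epsilon>\<close>, so for a given \<open>\<epsilon>\<close> the factor
  \<open>\<gamma>\<close> is only reached up to an additive \<open>\<epsilon>\<close>: if \<open>C = F = S\<close> are two points at distance 1 and
  \<open>l = 1\<close>, \<open>\<alpha> = \<beta> = 1\<close>, then the optimum is 0, while for \<open>\<epsilon> = 1\<close> the radius 1 is returned and the
  assignment may swap the points.  The last conjunct is the bound without additive error; it holds
  once \<open>\<epsilon>\<close> is small enough for the instance.\<close>

definition fair_k_cluster_approximates ::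
  "'a::metric_space set \<Rightarrow> 'a set \<Rightarrow> nat \<Rightarrow> (nat \<Rightarrow> 'a set) \<Rightarrow> nat \<Rightarrow> (nat \<Rightarrow> real) \<Rightarrow> (nat \<Rightarrow> real)
    \<Rightarrow> real \<Rightarrow> bool" where
  "fair_k_cluster_approximates C F l G k \<alpha> \<beta> \<gamma> \<longleftrightarrow>
     (\<forall>S. greedy_k_center C F k S \<longrightarrow>
        S \<subseteq> F \<and> card S \<le> k \<and>
        (\<forall>\<epsilon>>0. \<exists>\<rho>. fair_k_cluster_radius C l G \<alpha> \<beta> \<epsilon> S \<rho> \<and>
           \<rho> \<le> \<gamma> * fair_opt C F l G k \<alpha> \<beta> + \<epsilon> \<and>
           (\<exists>X. lp_solution C l G \<alpha> \<beta> S \<rho> X) \<and>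
           (\<forall>X. lp_solution C l G \<alpha> \<beta> S \<rho> X \<longrightarrow>
              fair_in_expectation C l G \<alpha> \<beta> S (randomized_assignment C l G S \<rho> X) \<and>
              (\<forall>\<phi> \<in> set_pmf (randomized_assignment C l G S \<rho> X).
                 \<phi> ` C \<subseteq> S \<and> cluster_cost C \<phi> \<le> \<rho>))) \<and>
        (\<exists>\<epsilon>\<^sub>0>0. \<forall>\<epsilon>. 0 < \<epsilon> \<and> \<epsilon> \<le> \<epsilon>\<^sub>0 \<longrightarrow>
           (\<forall>\<rho> X. fair_k_cluster_radius C l G \<alpha> \<beta> \<epsilon> S \<rho> \<and> lp_solution C l G \<alpha> \<beta> S \<rho> X \<longrightarrow>
              (\<forall>\<phi> \<in> set_pmf (randomized_assignment C l G S \<rho> X).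
                 cluster_cost C \<phi> \<le> \<gamma> * fair_opt C F l G k \<alpha> \<beta>))))"

end

theory Submission
  imports Defs
begin

text \<open>
  Let a fair clustering have cost \<open>L\<close>.  By the pigeonhole principle on its \<open>k\<close> clusters every client
  is within \<open>2 L + \<delta>\<close> of a greedy center, where \<open>\<delta>\<close> bounds the distance from a client to its closest
  point of \<open>F\<close>: \<open>\<delta> = L\<close> in general and \<open>\<delta> = 0\<close> if \<open>F = C\<close>.  A cluster center is thus within \<open>4 L\<close> of
  a greedy center, and within \<open>2 L\<close> if \<open>F = C\<close>, as it is then itself a client.  Moving whole clusters
  to greedy centers preserves the linear fairness constraints and costs one further \<open>L\<close>, which
  gives the factors 5 and 3.

  The program together with the covering test is solvable at radius \<open>r\<close> iff a fair fractional
  assignment of the clients within distance \<open>r\<close> exists: average over the cells in one direction, sum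
  over them in the other.  So feasibility is monotone in \<open>r\<close>, its threshold \<open>\<rho>\<^sub>0\<close> is one of the finitely
  many client-center distances, and the binary search encloses or converges to \<open>\<rho>\<^sub>0\<close>.
\<close>

section \<open>Covering radius of the greedy centers\<close>

lemma infdist_attained_finite:
  assumes "finite A" "A \<noteq> {}"
  obtains a where "a \<in> A" "infdist x A = dist x a"
proof -
  have "infdist x A = Min ((\<lambda>a. dist x a) ` A)"
    using assms by (simp add: infdist_def cInf_eq_Min)
  moreover have "Min ((\<lambda>a. dist x a) ` A) \<in> (\<lambda>a. dist x a) ` A"
    using assms by (intro Min_in) auto
  ultimately show thesis using that by auto
qed

text \<open>Otherwise the \<open>k\<close> chosen clients and \<open>v\<close> would lie in
  \<open>k + 1\<close> different clusters of \<open>T\<close>. Indeed, two clients of one cluster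
  are at most \<open>2 * L\<close> apart, so each is within \<open>2 * L + \<delta>\<close> of the
  greedy center of the other; a client chosen that close to the earlier centers cannot beat
  \<open>v\<close>, which is farther away. The parameter \<open>\<delta>\<close> lets one proof
  serve both approximation factors.\<close>

lemma greedy_k_center_dist:
  assumes greedy: "greedy_k_center C F k S"
    and fair: "fair_clustering C F l G k \<alpha> \<beta> T \<phi>"
    and cost: "\<And>v. v \<in> C \<Longrightarrow> dist v (\<phi> v) \<le> L"
    and near: "\<And>u \<sigma>. u \<in> C \<Longrightarrow> \<sigma> \<in> F \<Longrightarrow> \<forall>f\<in>F. dist u \<sigma> \<le> dist u f \<Longrightarrow> dist u \<sigma> \<le> \<delta>"
    and v: "v \<in> C"
  shows "\<exists>s\<in>S. dist v s \<le> 2 * L + \<delta>"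
proof (rule ccontr)
  assume "\<not> ?thesis"
  then have far: "\<And>s. s \<in> S \<Longrightarrow> dist v s > 2 * L + \<delta>" by force
  obtain us \<sigma> where \<sigma>: "\<And>u. u \<in> C \<Longrightarrow> \<sigma> u \<in> F \<and> (\<forall>f\<in>F. dist u (\<sigma> u) \<le> dist u f)"
    and us: "length us = k" "set us \<subseteq> C" "S = \<sigma> ` set us"
    and furthest: "\<And>i v. i < k \<Longrightarrow> v \<in> C - set (take i us) \<Longrightarrow>
           infdist v (\<sigma> ` set (take i us)) \<le> infdist (us ! i) (\<sigma> ` set (take i us))"
    using greedy unfolding greedy_k_center_def by blast
  have \<sigma>_near: "dist u (\<sigma> u) \<le> \<delta>" if "u \<in> C" for u
    using near[OF that] \<sigma>[OF that] by blast
  have T: "finite T" "card T = k" "\<phi> ` C \<subseteq> T"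
    using fair by (auto simp: fair_clustering_def)
  have L: "0 \<le> L" using cost[OF v] zero_le_dist order_trans by blast
  \<comment> \<open>The greedy rule compares a new choice only with clients not chosen before, so it
    applies to \<open>v\<close> only once \<open>v\<close> is known not to be among
    \<open>us\<close>.\<close>
  have v_notin: "v \<notin> set us"
  proof
    assume "v \<in> set us"
    then have "dist v (\<sigma> v) > 2 * L + \<delta>" using us far by auto
    then show False using \<sigma>_near[OF v] L by linarith
  qed
  have apart: "dist w (\<sigma> u) \<le> 2 * L + \<delta>" if "u \<in> C" "w \<in> C" "\<phi> u = \<phi> w" for u w
  proof -
    have "dist w (\<sigma> u) \<le> dist w (\<phi> w) + dist u (\<phi> u) + dist u (\<sigma> u)"
      using that(3) dist_triangle[of w "\<sigma> u" u] dist_triangle2[of w u "\<phi> w"] by simp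
    then show ?thesis using cost[of u] cost[of w] \<sigma>_near[of u] that by linarith
  qed
  \<comment> \<open>Index \<open>k\<close> stands for the uncovered client \<open>v\<close>, so
    \<open>{..k}\<close> supplies the \<open>k + 1\<close> pigeons.\<close>
  define g where "g i = \<phi> (if i < k then us ! i else v)" for i
  have us_in: "us ! i \<in> C" if "i < k" for i using us that by auto
  have "g i \<noteq> g j" if "i < j" "j \<le> k" for i j
  proof
    assume eq: "g i = g j"
    have i: "us ! i \<in> set (take j us)"
      using that us by (auto simp: in_set_conv_nth intro!: exI[of _ i])
    show False
    proof (cases "j < k")
      case False
      then have "\<phi> (us ! i) = \<phi> v" using eq that by (simp add: g_def)
      then have "dist v (\<sigma> (us ! i)) \<le> 2 * L + \<delta>" using apart us_in that v by auto
      moreover have "\<sigma> (us ! i) \<in> S" using us that by auto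
      ultimately show False using far by force
    next
      case True
      let ?S = "\<sigma> ` set (take j us)"
      have ne: "?S \<noteq> {}" "finite ?S" using that i by (auto simp del: take_eq_Nil)
      have "v \<in> C - set (take j us)" using v v_notin by (meson Diff_iff in_set_takeD)
      then have "infdist v ?S \<le> infdist (us ! j) ?S" using furthest True by blast
      also have "\<dots> \<le> dist (us ! j) (\<sigma> (us ! i))" using i by (intro infdist_le) auto
      also have "\<dots> \<le> 2 * L + \<delta>"
        using eq that True by (intro apart us_in) (auto simp: g_def)
      finally have "infdist v ?S \<le> 2 * L + \<delta>" .
      moreover obtain s where "s \<in> ?S" "infdist v ?S = dist v s"
        using infdist_attained_finite[OF ne(2,1)] by metis
      moreover have "?S \<subseteq> S" using us set_take_subset by fastforce
      ultimately show False using far by force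
    qed
  qed
  then have "inj_on g {..k}"
    by (intro inj_onI) (metis atMost_iff linorder_neqE_nat)
  moreover have "g ` {..k} \<subseteq> T" using T us_in v by (auto simp: g_def)
  ultimately have "card {..k} \<le> card T" using card_inj_on_le T(1) by blast
  then show False using T by simp
qed


section \<open>Fractional assignments and the linear program\<close>

locale fair_instance =
  fixes C S :: "'a::metric_space set" and l :: nat and G :: "nat \<Rightarrow> 'a set"
    and \<alpha> \<beta> :: "nat \<Rightarrow> real"
  assumes finite_C: "finite C" and C_ne: "C \<noteq> {}"
    and finite_S: "finite S" and S_ne: "S \<noteq> {}"
    and G_subset: "i \<in> {1..l} \<Longrightarrow> G i \<subseteq> C"
begin

text \<open>Here \<open>y v j\<close> is the share of client \<open>v\<close> given to center
  \<open>j\<close>. The cells of the program change with the radius, so its solutions at different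
  radii are hard to compare; here the radius only restricts the support of \<open>y\<close>, and the
  fairness constraints do not mention it.\<close>

definition fractional :: "real \<Rightarrow> ('a \<Rightarrow> 'a \<Rightarrow> real) \<Rightarrow> bool" where
  "fractional r y \<longleftrightarrow>
     (\<forall>v\<in>C. (\<Sum>j\<in>S. y v j) = 1 \<and>
        (\<forall>j\<in>S. 0 \<le> y v j \<and> (y v j \<noteq> 0 \<longrightarrow> dist v j \<le> r))) \<and>
     (\<forall>a\<in>{1..l}. \<forall>j\<in>S.
        \<beta> a * (\<Sum>v\<in>C. y v j) \<le> (\<Sum>v\<in>G a. y v j) \<and>
        (\<Sum>v\<in>G a. y v j) \<le> \<alpha> a * (\<Sum>v\<in>C. y v j))"

text \<open>Both tests of the loop body are needed: a client with no center within reach lies in no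
  cell, so the program alone does not notice it.\<close>

definition feasible_radius :: "real \<Rightarrow> bool" where
  "feasible_radius r \<longleftrightarrow> (\<forall>x\<in>C. infdist x S \<le> r) \<and> (\<exists>X. lp_solution C l G \<alpha> \<beta> S r X)"

definition distances :: "real set" where
  "distances = {dist x f | x f. x \<in> C \<and> f \<in> S}"

definition reachable :: "real \<Rightarrow> 'a \<Rightarrow> 'a set" where
  "reachable r v = {f \<in> S. v \<in> cball f r}"

lemma reachable_iff: "j \<in> reachable r v \<longleftrightarrow> j \<in> S \<and> dist v j \<le> r"
  by (auto simp: reachable_def dist_commute)

lemma set_signature: "set (signature l G v) = {i \<in> {1..l}. v \<in> G i}"
  by (simp add: signature_def)

lemma finite_distances: "finite distances"
proof -
  have "distances = (\<lambda>(x, f). dist x f) ` (C \<times> S)" by (auto simp: distances_def)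
  then show ?thesis using finite_C finite_S by simp
qed

lemma distances_ne: "distances \<noteq> {}"
  using C_ne S_ne by (auto simp: distances_def)

lemma distances_nonneg: "d \<in> distances \<Longrightarrow> 0 \<le> d"
  by (auto simp: distances_def)

text \<open>A point lies in \<open>joiner S S' r\<close> exactly if \<open>S'\<close> is its set of
  reachable centers, so the cells are the fibres of the map from a client to its signature and
  reachable set.\<close>

lemma cell_eq:
  assumes "S' \<subseteq> S"
  shows "cell C l G S c S' r = {v \<in> C. (signature l G v, reachable r v) = (c, S')}"
  using assms by (auto simp: cell_def joiner_def reachable_def)

lemma lp_cells_eq:
  "lp_cells C l G S r = (\<lambda>v. (signature l G v, reachable r v)) ` {v \<in> C. reachable r v \<noteq> {}}"
proof (intro set_eqI iffI; clarify)
  fix c S' assume "(c, S') \<in> lp_cells C l G S r"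
  then have "S' \<noteq> {}" "S' \<subseteq> S" "cell C l G S c S' r \<noteq> {}"
    by (auto simp: lp_cells_def card_gt_0_iff)
  then show "(c, S') \<in> (\<lambda>v. (signature l G v, reachable r v)) ` {v \<in> C. reachable r v \<noteq> {}}"
    by (auto simp: cell_eq)
next
  fix v assume v: "v \<in> C" "reachable r v \<noteq> {}"
  have sub: "reachable r v \<subseteq> S" by (auto simp: reachable_def)
  have "finite (cell C l G S (signature l G v) (reachable r v) r)"
    using finite_C by (simp add: cell_def)
  moreover have "v \<in> cell C l G S (signature l G v) (reachable r v) r"
    using v sub by (simp add: cell_eq)
  ultimately show "(signature l G v, reachable r v) \<in> lp_cells C l G S r"
    using v sub by (auto simp: lp_cells_def card_gt_0_iff)
qed

text \<open>The cells that contain \<open>j\<close> in their second component partition the clients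
  that can reach \<open>j\<close>. The remaining clients contribute 0 by the support hypothesis. The
  predicate \<open>P\<close> selects either all clients or those of one group.\<close>

lemma sum_lp_cells:
  fixes y :: "'a \<Rightarrow> real"
  assumes "\<And>v. v \<in> C \<Longrightarrow> P (signature l G v) \<Longrightarrow> y v \<noteq> 0 \<Longrightarrow> dist v j \<le> r" and j: "j \<in> S"
  shows "(\<Sum>(c, S') \<in> {(c, S') \<in> lp_cells C l G S r. j \<in> S' \<and> P c}. \<Sum>v\<in>cell C l G S c S' r. y v)
         = (\<Sum>v \<in> {v \<in> C. P (signature l G v)}. y v)"
proof -
  let ?K = "\<lambda>v. (signature l G v, reachable r v)"
  let ?V = "{v \<in> C. j \<in> reachable r v \<and> P (signature l G v)}"
  have I: "{(c, S') \<in> lp_cells C l G S r. j \<in> S' \<and> P c} = ?K ` ?V"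
    by (auto simp: lp_cells_eq)
  have "(\<Sum>(c, S') \<in> ?K ` ?V. \<Sum>v\<in>cell C l G S c S' r. y v)
      = (\<Sum>z \<in> ?K ` ?V. \<Sum>v\<in>{v \<in> ?V. ?K v = z}. y v)"
  proof (intro sum.cong refl, clarify)
    fix w assume "w \<in> C" "j \<in> reachable r w" "P (signature l G w)"
    moreover have "reachable r w \<subseteq> S" by (auto simp: reachable_def)
    ultimately show "(\<Sum>v\<in>cell C l G S (signature l G w) (reachable r w) r. y v)
        = (\<Sum>v\<in>{v \<in> ?V. ?K v = ?K w}. y v)"
      by (intro sum.cong) (auto simp: cell_eq)
  qed
  also have "\<dots> = (\<Sum>v\<in>?V. y v)"
    using finite_C by (intro sum.image_gen[symmetric]) simp
  also have "\<dots> = (\<Sum>v \<in> {v \<in> C. P (signature l G v)}. y v)"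
    using finite_C assms by (intro sum.mono_neutral_left) (auto simp: reachable_iff)
  finally show ?thesis by (simp only: I)
qed

lemma sum_lp_cells_fair:
  assumes "\<And>v. v \<in> C \<Longrightarrow> y v \<noteq> 0 \<Longrightarrow> dist v j \<le> r" "j \<in> S"
  shows "(\<Sum>(c, S') \<in> {(c, S') \<in> lp_cells C l G S r. j \<in> S'}. \<Sum>v\<in>cell C l G S c S' r. y v)
         = (\<Sum>v\<in>C. (y v :: real))"
    and "a \<in> {1..l} \<Longrightarrow>
      (\<Sum>(c, S') \<in> {(c, S') \<in> lp_cells C l G S r. j \<in> S' \<and> a \<in> set c}. \<Sum>v\<in>cell C l G S c S' r. y v)
         = (\<Sum>v\<in>G a. y v)"
proof -
  show "(\<Sum>(c, S') \<in> {(c, S') \<in> lp_cells C l G S r. j \<in> S'}. \<Sum>v\<in>cell C l G S c S' r. y v)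
         = (\<Sum>v\<in>C. y v)"
    using sum_lp_cells[of "\<lambda>_. True" y j r] assms by simp
  assume a: "a \<in> {1..l}"
  then have "{v \<in> C. a \<in> set (signature l G v)} = G a"
    using G_subset by (auto simp: set_signature)
  then show "(\<Sum>(c, S') \<in> {(c, S') \<in> lp_cells C l G S r. j \<in> S' \<and> a \<in> set c}.
        \<Sum>v\<in>cell C l G S c S' r. y v) = (\<Sum>v\<in>G a. y v)"
    using sum_lp_cells[of "\<lambda>c. a \<in> set c" y j r] assms by simp
qed

text \<open>Summing the shares over each cell solves the program. A client's shares sum to 1, so
  some share is nonzero and its center passes the covering test.\<close>

lemma fractional_imp_feasible:
  assumes y: "fractional r y"
  shows "feasible_radius r"
proof -
  have y_sum: "(\<Sum>j\<in>S. y v j) = 1" if "v \<in> C" for v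
    using y that by (auto simp: fractional_def)
  have y_near: "dist v j \<le> r" if "v \<in> C" "j \<in> S" "y v j \<noteq> 0" for v j
    using y that unfolding fractional_def by blast
  have y_nonneg: "0 \<le> y v j" if "v \<in> C" "j \<in> S" for v j
    using y that unfolding fractional_def by blast
  define X where "X c S' j = (\<Sum>v\<in>cell C l G S c S' r. y v j)" for c S' j
  have "infdist x S \<le> r" if x: "x \<in> C" for x
  proof -
    have "\<exists>j\<in>S. y x j \<noteq> 0"
      using y_sum[OF x] by (metis sum.neutral zero_neq_one)
    then obtain j where "j \<in> S" "dist x j \<le> r" using y_near x by blast
    then show ?thesis using infdist_le[of j S x] by linarith
  qed
  moreover have "lp_solution C l G \<alpha> \<beta> S r X"
    unfolding lp_solution_def
  proof (intro conjI ballI; (clarify)?)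
    fix a j assume a: "a \<in> {1..l}" and j: "j \<in> S"
    have eqs:
      "(\<Sum>(c, S') \<in> {(c, S') \<in> lp_cells C l G S r. j \<in> S'}. X c S' j) = (\<Sum>v\<in>C. y v j)"
      "(\<Sum>(c, S') \<in> {(c, S') \<in> lp_cells C l G S r. j \<in> S' \<and> a \<in> set c}. X c S' j) = (\<Sum>v\<in>G a. y v j)"
      unfolding X_def by (intro sum_lp_cells_fair y_near j a; assumption)+
    show "\<beta> a * (\<Sum>(c, S') \<in> {(c, S') \<in> lp_cells C l G S r. j \<in> S'}. X c S' j)
          \<le> (\<Sum>(c, S') \<in> {(c, S') \<in> lp_cells C l G S r. j \<in> S' \<and> a \<in> set c}. X c S' j)"
      "(\<Sum>(c, S') \<in> {(c, S') \<in> lp_cells C l G S r. j \<in> S' \<and> a \<in> set c}. X c S' j)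
          \<le> \<alpha> a * (\<Sum>(c, S') \<in> {(c, S') \<in> lp_cells C l G S r. j \<in> S'}. X c S' j)"
      using y a j unfolding eqs fractional_def by blast+
  next
    fix c S' assume cS: "(c, S') \<in> lp_cells C l G S r"
    then have S': "S' \<subseteq> S" by (auto simp: lp_cells_def)
    have "(\<Sum>j\<in>S'. X c S' j) = (\<Sum>v\<in>cell C l G S c S' r. \<Sum>j\<in>S'. y v j)"
      unfolding X_def by (rule sum.swap)
    also have "\<dots> = (\<Sum>v\<in>cell C l G S c S' r. 1)"
    proof (intro sum.cong refl)
      fix v assume "v \<in> cell C l G S c S' r"
      then have v: "v \<in> C" "reachable r v = S'" using S' by (auto simp: cell_eq)
      \<comment> \<open>Passing from \<open>S'\<close> to \<open>S\<close> adds only unreachable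
        centers, whose shares vanish.\<close>
      have "y v j = 0" if "j \<in> S" "\<not> dist v j \<le> r" for j
        using y_near that v by blast
      then have "(\<Sum>j\<in>S'. y v j) = (\<Sum>j\<in>S. y v j)"
        using S' finite_S
        by (intro sum.mono_neutral_left) (auto simp: v(2)[symmetric] reachable_iff)
      then show "(\<Sum>j\<in>S'. y v j) = 1" using y_sum v by simp
    qed
    finally show "(\<Sum>j\<in>S'. X c S' j) = real (card (cell C l G S c S' r))" by simp
    fix j assume "j \<in> S'"
    then show "0 \<le> X c S' j"
      unfolding X_def using S' y_nonneg by (intro sum_nonneg) (auto simp: cell_def)
  qed
  ultimately show ?thesis unfolding feasible_radius_def by blast
qed

text \<open>\<open>embed_pmf\<close> has the intended values only for nonnegative weights of total
  mass 1. Covering makes the reachable set of \<open>v\<close> nonempty, so \<open>v\<close> lies in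
  a cell of the program, whose equality constraint gives the total mass.\<close>

lemma pmf_center_pmf:
  assumes near: "\<And>x. x \<in> C \<Longrightarrow> infdist x S \<le> r" and X: "lp_solution C l G \<alpha> \<beta> S r X"
    and v: "v \<in> C"
  shows "pmf (center_pmf C l G S r X v) j =
    (if j \<in> reachable r v then X (signature l G v) (reachable r v) j /
       real (card (cell C l G S (signature l G v) (reachable r v) r)) else 0)"
proof -
  let ?S = "reachable r v" and ?c = "signature l G v"
  let ?n = "real (card (cell C l G S ?c ?S r))"
  let ?p = "\<lambda>j. if j \<in> ?S then X ?c ?S j / ?n else 0"
  obtain s where "s \<in> S" "infdist v S = dist v s"
    using infdist_attained_finite[OF finite_S S_ne] by metis
  then have "?S \<noteq> {}" using near[OF v] by (auto simp: reachable_iff)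
  then have mem: "(?c, ?S) \<in> lp_cells C l G S r" using v by (auto simp: lp_cells_eq)
  then have n: "?n > 0" by (auto simp: lp_cells_def)
  have sum: "(\<Sum>j\<in>?S. X ?c ?S j) = ?n" and nn: "\<And>j. j \<in> ?S \<Longrightarrow> 0 \<le> X ?c ?S j"
    using X mem unfolding lp_solution_def by blast+
  have fin: "finite ?S" using finite_S by (simp add: reachable_def)
  have nn': "0 \<le> ?p j" for j using nn n by simp
  have "(\<integral>\<^sup>+ j. ennreal (?p j) \<partial>count_space UNIV) = (\<Sum>j\<in>?S. ennreal (?p j))"
    using fin by (intro nn_integral_count_space') auto
  also have "\<dots> = ennreal (\<Sum>j\<in>?S. ?p j)" using nn' by (intro sum_ennreal)
  also have "(\<Sum>j\<in>?S. ?p j) = 1"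
    using sum n by (simp add: sum_divide_distrib[symmetric])
  finally have "pmf (embed_pmf ?p) j = ?p j" using nn' by (intro pmf_embed_pmf) auto
  then show ?thesis by (simp only: center_pmf_def Let_def reachable_def[symmetric])
qed

text \<open>The assignment probabilities average \<open>X\<close> over each cell: they are constant
  there, and adding them up over the cell gives back \<open>X\<close>. Hence the constraints of the
  program become those of \<open>fractional\<close>.\<close>

lemma lp_solution_imp_fractional:
  assumes near: "\<And>x. x \<in> C \<Longrightarrow> infdist x S \<le> r" and X: "lp_solution C l G \<alpha> \<beta> S r X"
  shows "fractional r (\<lambda>v. pmf (center_pmf C l G S r X v))"
proof -
  let ?y = "\<lambda>v. pmf (center_pmf C l G S r X v)"
  note y_eq = pmf_center_pmf[OF near X]
  have supp: "j \<in> S \<and> dist v j \<le> r" if "v \<in> C" "?y v j \<noteq> 0" for v j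
    using that y_eq[of v j] by (auto simp: reachable_iff split: if_splits)
  have y_sum: "(\<Sum>j\<in>S. ?y v j) = 1" if "v \<in> C" for v
    using finite_S supp[OF that] by (intro sum_pmf_eq_1) (auto simp: set_pmf_iff)
  have cell_sum: "(\<Sum>v\<in>cell C l G S c S' r. ?y v j) = X c S' j"
    if "(c, S') \<in> lp_cells C l G S r" "j \<in> S'" for c S' j
  proof -
    from that have S': "S' \<subseteq> S" and pos: "card (cell C l G S c S' r) > 0"
      by (auto simp: lp_cells_def)
    have "(\<Sum>v\<in>cell C l G S c S' r. ?y v j) =
        (\<Sum>v\<in>cell C l G S c S' r. X c S' j / real (card (cell C l G S c S' r)))"
    proof (intro sum.cong refl)
      fix v assume "v \<in> cell C l G S c S' r"
      then have "v \<in> C" "signature l G v = c" "reachable r v = S'"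
        using S' by (auto simp: cell_eq)
      then show "?y v j = X c S' j / real (card (cell C l G S c S' r))"
        using y_eq[of v j] that by simp
    qed
    then show ?thesis using pos by simp
  qed
  have "\<beta> a * (\<Sum>v\<in>C. ?y v j) \<le> (\<Sum>v\<in>G a. ?y v j) \<and> (\<Sum>v\<in>G a. ?y v j) \<le> \<alpha> a * (\<Sum>v\<in>C. ?y v j)"
    if a: "a \<in> {1..l}" and j: "j \<in> S" for a j
  proof -
    have "(\<Sum>(c, S') \<in> {(c, S') \<in> lp_cells C l G S r. j \<in> S'}. X c S' j) =
        (\<Sum>(c, S') \<in> {(c, S') \<in> lp_cells C l G S r. j \<in> S'}. \<Sum>v\<in>cell C l G S c S' r. ?y v j)"
      by (intro sum.cong) (auto simp: cell_sum)
    also have "\<dots> = (\<Sum>v\<in>C. ?y v j)"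
      using supp j by (intro sum_lp_cells_fair(1)[where y = "\<lambda>v. ?y v j"]) auto
    finally have 1:
      "(\<Sum>(c, S') \<in> {(c, S') \<in> lp_cells C l G S r. j \<in> S'}. X c S' j) = (\<Sum>v\<in>C. ?y v j)" .
    have "(\<Sum>(c, S') \<in> {(c, S') \<in> lp_cells C l G S r. j \<in> S' \<and> a \<in> set c}. X c S' j) =
        (\<Sum>(c, S') \<in> {(c, S') \<in> lp_cells C l G S r. j \<in> S' \<and> a \<in> set c}.
           \<Sum>v\<in>cell C l G S c S' r. ?y v j)"
      by (intro sum.cong) (auto simp: cell_sum)
    also have "\<dots> = (\<Sum>v\<in>G a. ?y v j)"
      using supp j a by (intro sum_lp_cells_fair(2)[where y = "\<lambda>v. ?y v j"]) auto
    finally have 2: "(\<Sum>(c, S') \<in> {(c, S') \<in> lp_cells C l G S r. j \<in> S' \<and> a \<in> set c}. X c S' j)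
      = (\<Sum>v\<in>G a. ?y v j)" .
    have "\<beta> a * (\<Sum>(c, S') \<in> {(c, S') \<in> lp_cells C l G S r. j \<in> S'}. X c S' j)
          \<le> (\<Sum>(c, S') \<in> {(c, S') \<in> lp_cells C l G S r. j \<in> S' \<and> a \<in> set c}. X c S' j) \<and>
        (\<Sum>(c, S') \<in> {(c, S') \<in> lp_cells C l G S r. j \<in> S' \<and> a \<in> set c}. X c S' j)
          \<le> \<alpha> a * (\<Sum>(c, S') \<in> {(c, S') \<in> lp_cells C l G S r. j \<in> S'}. X c S' j)"
      using X a j unfolding lp_solution_def by blast
    then show ?thesis by (simp only: 1 2)
  qed
  then show ?thesis
    using supp y_sum unfolding fractional_def by auto
qed

lemma feasible_radius_iff: "feasible_radius r \<longleftrightarrow> (\<exists>y. fractional r y)"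
  using fractional_imp_feasible lp_solution_imp_fractional
  unfolding feasible_radius_def by blast

text \<open>Only the comparisons of \<open>r\<close> with the finitely many elements of
  \<open>distances\<close> matter, so the least feasible distance is the threshold.\<close>

lemma feasible_radius_threshold:
  assumes "feasible_radius r"
  obtains \<rho> where "\<rho> \<in> distances" "\<And>r. feasible_radius r \<longleftrightarrow> \<rho> \<le> r"
proof -
  have mono: "feasible_radius r" if feas: "feasible_radius r'" and le: "r' \<le> r" for r r'
  proof -
    obtain y where y: "fractional r' y" using feas feasible_radius_iff by blast
    have "dist v j \<le> r" if "v \<in> C" "j \<in> S" "y v j \<noteq> 0" for v j
      using that y order_trans[OF _ le] unfolding fractional_def by blast
    then have "fractional r y" using y unfolding fractional_def by blast
    then show ?thesis using feasible_radius_iff by blast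
  qed
  \<comment> \<open>The same \<open>y\<close> still works after lowering \<open>r\<close> to the
    largest distance not above it; one exists because some client has a nonzero share.\<close>
  have round: "\<exists>d\<in>distances. d \<le> r \<and> feasible_radius d" if feas: "feasible_radius r" for r
  proof -
    obtain y where y: "fractional r y" using feas feasible_radius_iff by blast
    let ?D = "{d \<in> distances. d \<le> r}"
    obtain v where v: "v \<in> C" using C_ne by blast
    then have "(\<Sum>j\<in>S. y v j) = 1" using y unfolding fractional_def by blast
    then obtain j where "j \<in> S" "y v j \<noteq> 0" by (metis sum.neutral zero_neq_one)
    then have "dist v j \<in> ?D" using v y by (auto simp: distances_def fractional_def)
    then have D: "finite ?D" "?D \<noteq> {}" using finite_distances by auto
    have "dist v j \<le> Max ?D" if "v \<in> C" "j \<in> S" "y v j \<noteq> 0" for v j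
      using that y D by (intro Max_ge) (auto simp: distances_def fractional_def)
    then have "fractional (Max ?D) y" using y unfolding fractional_def by blast
    then show ?thesis using Max_in[OF D] feasible_radius_iff by blast
  qed
  let ?A = "{d \<in> distances. feasible_radius d}"
  have A: "finite ?A" "?A \<noteq> {}" using round[OF assms] finite_distances by auto
  show thesis
  proof
    show "Min ?A \<in> distances" using Min_in[OF A] by blast
    show "feasible_radius r \<longleftrightarrow> Min ?A \<le> r" for r
    proof
      assume "feasible_radius r"
      from round[OF this] obtain d where "d \<in> ?A" "d \<le> r" by blast
      then show "Min ?A \<le> r" using Min_le[OF A(1)] order_trans by blast
    next
      assume "Min ?A \<le> r"
      then show "feasible_radius r" using Min_in[OF A] mono by blast
    qed
  qed
qed

text \<open>The constraints are linear and homogeneous in the cluster sizes, so they can be added up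
  over all clusters that \<open>h\<close> moves to the same center. A center that receives no
  cluster gets empty sums.\<close>

lemma fair_clustering_imp_fractional:
  assumes fair: "fair_clustering C F l G k \<alpha> \<beta> T \<phi>"
    and near: "\<And>v. v \<in> C \<Longrightarrow> h (\<phi> v) \<in> S \<and> dist v (h (\<phi> v)) \<le> r"
  shows "fractional r (\<lambda>v j. of_bool (h (\<phi> v) = j))"
proof -
  have T: "finite T" "\<phi> ` C \<subseteq> T" using fair by (auto simp: fair_clustering_def)
  have merge: "(\<Sum>v\<in>A. of_bool (h (\<phi> v) = j)) = (\<Sum>f\<in>{f \<in> T. h f = j}. real (card {v \<in> A. \<phi> v = f}))"
    if A: "A \<subseteq> C" for A j
  proof -
    have fin: "finite A" using A finite_C finite_subset by blast
    have "(\<Sum>v\<in>A. of_bool (h (\<phi> v) = j)) = (\<Sum>v\<in>{v \<in> A. h (\<phi> v) = j}. 1 :: real)"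
      using fin by (simp add: of_bool_def sum.If_cases Int_def)
    also have "\<dots> = (\<Sum>f\<in>{f \<in> T. h f = j}. \<Sum>v\<in>{v \<in> {v \<in> A. h (\<phi> v) = j}. \<phi> v = f}. 1)"
      using fin T A by (intro sum.group[symmetric]) auto
    also have "\<dots> = (\<Sum>f\<in>{f \<in> T. h f = j}. real (card {v \<in> A. \<phi> v = f}))"
      by (intro sum.cong refl) (auto intro!: arg_cong[where f = card])
    finally show ?thesis .
  qed
  have "\<beta> a * (\<Sum>v\<in>C. of_bool (h (\<phi> v) = j)) \<le> (\<Sum>v\<in>G a. of_bool (h (\<phi> v) = j)) \<and>
      (\<Sum>v\<in>G a. of_bool (h (\<phi> v) = j)) \<le> \<alpha> a * (\<Sum>v\<in>C. of_bool (h (\<phi> v) = j))"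
    if a: "a \<in> {1..l}" for a j
    unfolding merge[OF order_refl] merge[OF G_subset[OF a]] sum_distrib_left
    using fair a unfolding fair_clustering_def by (intro conjI sum_mono) auto
  then show ?thesis
    using near finite_S by (auto simp: fractional_def of_bool_def)
qed

section \<open>Expectation and support of the randomized assignment\<close>

lemma expectation_card_cluster:
  assumes A: "A \<subseteq> C"
  shows "measure_pmf.expectation (randomized_assignment C l G S r X)
      (\<lambda>\<phi>. real (card {v \<in> A. \<phi> v = f})) = (\<Sum>v\<in>A. pmf (center_pmf C l G S r X v) f)"
proof -
  let ?p = "randomized_assignment C l G S r X"
  have fin: "finite A" using A finite_C finite_subset by blast
  have "measure_pmf.expectation ?p (\<lambda>\<phi>. real (card {v \<in> A. \<phi> v = f})) =
      measure_pmf.expectation ?p (\<lambda>\<phi>. \<Sum>v\<in>A. indicator {\<phi>. \<phi> v = f} \<phi>)"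
    using fin by (simp add: indicator_def of_bool_def sum.If_cases Int_def)
  also have "\<dots> = (\<Sum>v\<in>A. measure_pmf.expectation ?p (indicator {\<phi>. \<phi> v = f}))"
    by (intro Bochner_Integration.integral_sum integrable_real_indicator) (auto simp: less_top[symmetric])
  also have "\<dots> = (\<Sum>v\<in>A. pmf (center_pmf C l G S r X v) f)"
  proof (intro sum.cong refl)
    fix v assume "v \<in> A"
    then have "center_pmf C l G S r X v = map_pmf (\<lambda>\<phi>. \<phi> v) ?p"
      using A finite_C by (auto simp: randomized_assignment_def Pi_pmf_component)
    then show "measure_pmf.expectation ?p (indicator {\<phi>. \<phi> v = f}) = pmf (center_pmf C l G S r X v) f"
      by (simp add: pmf_map vimage_def)
  qed
  finally show ?thesis .
qed

text \<open>By linearity, expected cluster sizes are sums of the marginal probabilities, so this is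
  the fairness part of \<open>fractional\<close> for those marginals.\<close>

lemma fair_in_expectation_randomized_assignment:
  assumes "\<And>x. x \<in> C \<Longrightarrow> infdist x S \<le> r" "lp_solution C l G \<alpha> \<beta> S r X"
  shows "fair_in_expectation C l G \<alpha> \<beta> S (randomized_assignment C l G S r X)"
  using lp_solution_imp_fractional[OF assms] G_subset
  unfolding fair_in_expectation_def fractional_def
  by (simp add: expectation_card_cluster)

lemma set_randomized_assignment:
  assumes "\<And>x. x \<in> C \<Longrightarrow> infdist x S \<le> r" "lp_solution C l G \<alpha> \<beta> S r X"
    and "\<phi> \<in> set_pmf (randomized_assignment C l G S r X)" and v: "v \<in> C"
  shows "\<phi> v \<in> S" "dist v (\<phi> v) \<le> r"
proof -
  have "\<phi> v \<in> set_pmf (center_pmf C l G S r X v)"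
    using assms(3) v finite_C set_Pi_pmf_subset'[OF finite_C]
    by (fastforce simp: randomized_assignment_def PiE_dflt_def)
  then have "\<phi> v \<in> reachable r v"
    using pmf_center_pmf[OF assms(1,2) v, of "\<phi> v"] by (auto simp: set_pmf_iff split: if_splits)
  then show "\<phi> v \<in> S" "dist v (\<phi> v) \<le> r" by (auto simp: reachable_iff)
qed

lemma cluster_cost_le_iff: "cluster_cost C \<phi> \<le> r \<longleftrightarrow> (\<forall>v\<in>C. dist v (\<phi> v) \<le> r)"
  unfolding cluster_cost_def using finite_C C_ne by (subst Max_le_iff) auto


section \<open>The binary search\<close>

context
  fixes \<rho>\<^sub>0 :: real
  assumes threshold: "\<And>r. feasible_radius r \<longleftrightarrow> \<rho>\<^sub>0 \<le> r" and attained: "\<rho>\<^sub>0 \<in> distances"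
begin

text \<open>From here on the search depends on the instance only through
  \<open>\<rho>\<^sub>0\<close> and the initial interval.\<close>

lemma search_step_eq:
  "search_step C l G \<alpha> \<beta> S s =
     (let r = (lower s + upper s) / 2 in
      if \<rho>\<^sub>0 \<le> r then s\<lparr>upper := r, feasible := True, radius := r\<rparr>
      else s\<lparr>lower := r, feasible := False, radius := r\<rparr>)"
  unfolding search_step_def threshold[symmetric] feasible_radius_def Let_def
  by (auto simp: not_less)

text \<open>Bisection around \<open>\<rho>\<^sub>0\<close>. The conjunct on \<open>feasible\<close>
  identifies the radius of a terminated search with the upper end, hence puts it on the feasible
  side of \<open>\<rho>\<^sub>0\<close>.\<close>

lemma search_invariant:
  defines "s n \<equiv> (search_step C l G \<alpha> \<beta> S ^^ n) (search_init C S)"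
  shows "lower (s n) \<le> \<rho>\<^sub>0 \<and> \<rho>\<^sub>0 \<le> upper (s n) \<and>
    upper (s n) - lower (s n) = 2 * Max distances / 2 ^ n \<and>
    (feasible (s n) \<longrightarrow> radius (s n) = upper (s n)) \<and>
    (n > 0 \<longrightarrow> lower (s n) \<le> radius (s n) \<and> radius (s n) \<le> upper (s n))"
proof (induction n)
  case 0
  have "\<rho>\<^sub>0 \<le> Max distances" "0 \<le> \<rho>\<^sub>0"
    using attained finite_distances distances_nonneg by auto
  then show ?case
    by (simp add: s_def search_init_def distances_def[symmetric])
next
  case (Suc n)
  have "s (Suc n) = search_step C l G \<alpha> \<beta> S (s n)" by (simp add: s_def)
  with Suc show ?case
    by (auto simp: search_step_eq Let_def field_simps)
qed

lemma search_limit: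
  "(\<lambda>n. radius ((search_step C l G \<alpha> \<beta> S ^^ n) (search_init C S))) \<longlonglongrightarrow> \<rho>\<^sub>0"
    (is "?f \<longlonglongrightarrow> _")
proof -
  have "(\<lambda>n. 2 * Max distances * (1 / 2) ^ n) \<longlonglongrightarrow> 2 * Max distances * 0"
    by (intro tendsto_mult tendsto_const LIMSEQ_power_zero) simp
  then have "(\<lambda>n. 2 * Max distances / 2 ^ n) \<longlonglongrightarrow> 0" by (simp add: power_one_over)
  moreover have "\<forall>\<^sub>F n in sequentially. norm (?f n - \<rho>\<^sub>0) \<le> 2 * Max distances / 2 ^ n"
    using eventually_gt_at_top[of 0]
  proof eventually_elim
    case (elim n)
    then show ?case using search_invariant[of n] by auto
  qed
  ultimately have "(\<lambda>n. ?f n - \<rho>\<^sub>0) \<longlonglongrightarrow> 0" by (rule Lim_null_comparison[rotated])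
  then show ?thesis by (simp add: LIM_zero_iff)
qed

lemma fair_k_cluster_radius_exists: "\<exists>r. fair_k_cluster_radius C l G \<alpha> \<beta> \<epsilon> S r"
  using search_limit
  by (cases "while_option (search_cond \<epsilon>) (search_step C l G \<alpha> \<beta> S) (search_init C S)")
    (auto simp: fair_k_cluster_radius_def)

text \<open>A search that stops returns the upper end of an interval of length at most
  \<open>\<epsilon>\<close> around \<open>\<rho>\<^sub>0\<close>; one that runs forever has the
  limit \<open>\<rho>\<^sub>0\<close> itself.\<close>

lemma fair_k_cluster_radius_bounds:
  assumes "fair_k_cluster_radius C l G \<alpha> \<beta> \<epsilon> S r" "\<epsilon> > 0"
  shows "\<rho>\<^sub>0 \<le> r \<and> r \<le> \<rho>\<^sub>0 + \<epsilon>"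
proof (cases "while_option (search_cond \<epsilon>) (search_step C l G \<alpha> \<beta> S) (search_init C S)")
  case None
  then have "r = \<rho>\<^sub>0"
    using assms(1) search_limit LIMSEQ_unique by (auto simp: fair_k_cluster_radius_def)
  then show ?thesis using assms(2) by simp
next
  case (Some s)
  then obtain n where "s = (search_step C l G \<alpha> \<beta> S ^^ n) (search_init C S)" "\<not> search_cond \<epsilon> s"
    using while_option_stop2 by metis
  moreover have "r = radius s" using assms(1) Some by (simp add: fair_k_cluster_radius_def)
  ultimately show ?thesis using search_invariant[of n] by (auto simp: search_cond_def)
qed

end

end


section \<open>The approximation factor\<close>

text \<open>The two factors differ only in the hypothesis \<open>merge\<close>. As \<open>h\<close>
  is applied to \<open>\<phi> v\<close>, it moves whole clusters, which preserves fairness.\<close>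

lemma fair_k_cluster_approximates_if_feasible:
  assumes C: "finite C" "C \<noteq> {}" and G: "\<And>i. i \<in> {1..l} \<Longrightarrow> G i \<subseteq> C"
    and ex: "\<exists>T \<phi>. fair_clustering C F l G k \<alpha> \<beta> T \<phi>" and \<gamma>: "\<gamma> > 0"
    and merge: "\<And>S T \<phi>. greedy_k_center C F k S \<Longrightarrow> fair_clustering C F l G k \<alpha> \<beta> T \<phi> \<Longrightarrow>
      \<exists>h. \<forall>v\<in>C. h (\<phi> v) \<in> S \<and> dist v (h (\<phi> v)) \<le> \<gamma> * cluster_cost C \<phi>"
  shows "fair_k_cluster_approximates C F l G k \<alpha> \<beta> \<gamma>"
  unfolding fair_k_cluster_approximates_def
proof (rule allI, rule impI)
  fix S assume S: "greedy_k_center C F k S"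
  obtain T \<phi> where fair: "fair_clustering C F l G k \<alpha> \<beta> T \<phi>" using ex by blast
  obtain us \<sigma> where "\<forall>u\<in>C. \<sigma> u \<in> F" "length us = k" "set us \<subseteq> C" "S = \<sigma> ` set us"
    using S unfolding greedy_k_center_def by blast
  then have SF: "S \<subseteq> F" and card: "card S \<le> k" and finS: "finite S"
    using card_image_le[of "set us" \<sigma>] card_length[of us] by auto
  \<comment> \<open>Any client is moved to some greedy center, which also rules out
    \<open>k = 0\<close>.\<close>
  have "S \<noteq> {}" using merge[OF S fair] C by blast
  then interpret fair_instance C S l G \<alpha> \<beta>
    using C G finS by unfold_locales auto
  have feas: "feasible_radius (\<gamma> * cluster_cost C \<phi>)"
    if fair: "fair_clustering C F l G k \<alpha> \<beta> T \<phi>" for T \<phi>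
  proof -
    obtain h where "\<forall>v\<in>C. h (\<phi> v) \<in> S \<and> dist v (h (\<phi> v)) \<le> \<gamma> * cluster_cost C \<phi>"
      using merge[OF S fair] by blast
    then show ?thesis
      using fair_clustering_imp_fractional[OF fair, of h] feasible_radius_iff by blast
  qed
  obtain \<rho>\<^sub>0 where \<rho>\<^sub>0: "\<rho>\<^sub>0 \<in> distances" "\<And>r. feasible_radius r \<longleftrightarrow> \<rho>\<^sub>0 \<le> r"
    using feasible_radius_threshold[OF feas[OF fair]] by metis
  \<comment> \<open>The optimum is an infimum, so it is bounded below through every fair clustering:
    \<open>\<gamma>\<close> times its cost is a feasible radius and thus at least
    \<open>\<rho>\<^sub>0\<close>.\<close>
  have "\<rho>\<^sub>0 / \<gamma> \<le> fair_opt C F l G k \<alpha> \<beta>"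
    unfolding fair_opt_def
  proof (rule cInf_greatest)
    show "{cluster_cost C \<phi> | S \<phi>. fair_clustering C F l G k \<alpha> \<beta> S \<phi>} \<noteq> {}" using ex by blast
    show "\<rho>\<^sub>0 / \<gamma> \<le> x" if "x \<in> {cluster_cost C \<phi> | S \<phi>. fair_clustering C F l G k \<alpha> \<beta> S \<phi>}" for x
      using that feas \<rho>\<^sub>0(2) \<gamma> by (auto simp: field_simps)
  qed
  then have opt: "\<rho>\<^sub>0 \<le> \<gamma> * fair_opt C F l G k \<alpha> \<beta>" using \<gamma> by (simp add: field_simps)
  note bounds = fair_k_cluster_radius_bounds[OF \<rho>\<^sub>0(2,1)]
  have near: "\<And>x. x \<in> C \<Longrightarrow> infdist x S \<le> r" if "\<rho>\<^sub>0 \<le> r" for r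
    using that \<rho>\<^sub>0(2)[of r] by (auto simp: feasible_radius_def)
  have approx: "\<exists>r. fair_k_cluster_radius C l G \<alpha> \<beta> \<epsilon> S r \<and>
       r \<le> \<gamma> * fair_opt C F l G k \<alpha> \<beta> + \<epsilon> \<and>
       (\<exists>X. lp_solution C l G \<alpha> \<beta> S r X) \<and>
       (\<forall>X. lp_solution C l G \<alpha> \<beta> S r X \<longrightarrow>
          fair_in_expectation C l G \<alpha> \<beta> S (randomized_assignment C l G S r X) \<and>
          (\<forall>\<phi> \<in> set_pmf (randomized_assignment C l G S r X). \<phi> ` C \<subseteq> S \<and> cluster_cost C \<phi> \<le> r))"
    if \<epsilon>: "\<epsilon> > 0" for \<epsilon>
  proof -
    obtain r where r: "fair_k_cluster_radius C l G \<alpha> \<beta> \<epsilon> S r"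
      using fair_k_cluster_radius_exists[OF \<rho>\<^sub>0(2,1)] by blast
    have le: "\<rho>\<^sub>0 \<le> r" "r \<le> \<rho>\<^sub>0 + \<epsilon>" using bounds[OF r \<epsilon>] by auto
    have "\<exists>X. lp_solution C l G \<alpha> \<beta> S r X"
      using \<rho>\<^sub>0(2)[of r] le by (auto simp: feasible_radius_def)
    moreover have "r \<le> \<gamma> * fair_opt C F l G k \<alpha> \<beta> + \<epsilon>" using le opt by linarith
    ultimately show ?thesis
      using r fair_in_expectation_randomized_assignment[OF near[OF le(1)]]
        set_randomized_assignment[OF near[OF le(1)]]
      by (intro exI[of _ r]) (auto simp: cluster_cost_le_iff)
  qed
  \<comment> \<open>Assignment distances lie in the finite set \<open>distances\<close>, so an \<open>\<epsilon>\<close> below the gap above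
    \<open>\<rho>\<^sub>0\<close> leaves no room for an error.\<close>
  define \<epsilon>\<^sub>0 where "\<epsilon>\<^sub>0 = Min (insert 1 ((\<lambda>d. (d - \<rho>\<^sub>0) / 2) ` {d \<in> distances. d > \<rho>\<^sub>0}))"
  have pos: "\<epsilon>\<^sub>0 > 0"
    using finite_distances by (auto simp: \<epsilon>\<^sub>0_def)
  have exact: "cluster_cost C \<phi> \<le> \<gamma> * fair_opt C F l G k \<alpha> \<beta>"
    if \<epsilon>: "0 < \<epsilon>" "\<epsilon> \<le> \<epsilon>\<^sub>0" and r: "fair_k_cluster_radius C l G \<alpha> \<beta> \<epsilon> S r"
      and X: "lp_solution C l G \<alpha> \<beta> S r X"
      and \<phi>: "\<phi> \<in> set_pmf (randomized_assignment C l G S r X)" for \<epsilon> r X \<phi>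
  proof -
    have le: "\<rho>\<^sub>0 \<le> r" "r \<le> \<rho>\<^sub>0 + \<epsilon>" using bounds[OF r \<epsilon>(1)] by auto
    have "dist v (\<phi> v) \<le> \<rho>\<^sub>0" if v: "v \<in> C" for v
    proof (rule ccontr)
      assume gt: "\<not> dist v (\<phi> v) \<le> \<rho>\<^sub>0"
      have d: "\<phi> v \<in> S" "dist v (\<phi> v) \<le> r"
        using set_randomized_assignment[OF near[OF le(1)] X \<phi> v] by auto
      then have "dist v (\<phi> v) \<in> distances" using v by (auto simp: distances_def)
      then have "\<epsilon>\<^sub>0 \<le> (dist v (\<phi> v) - \<rho>\<^sub>0) / 2"
        unfolding \<epsilon>\<^sub>0_def using gt finite_distances by (intro Min_le) auto
      \<comment> \<open>The halving in \<open>\<epsilon>\<^sub>0\<close> makes the contradiction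
        strict: the excess over \<open>\<rho>\<^sub>0\<close> is at most \<open>\<epsilon>\<close>,
        hence below \<open>2 * \<epsilon>\<^sub>0\<close>.\<close>
      then have "2 * \<epsilon>\<^sub>0 \<le> dist v (\<phi> v) - \<rho>\<^sub>0" by simp
      then show False using d(2) le(2) \<epsilon> by linarith
    qed
    then show ?thesis using opt by (auto simp: cluster_cost_le_iff intro: order_trans)
  qed
  show "S \<subseteq> F \<and> card S \<le> k \<and>
        (\<forall>\<epsilon>>0. \<exists>\<rho>. fair_k_cluster_radius C l G \<alpha> \<beta> \<epsilon> S \<rho> \<and>
           \<rho> \<le> \<gamma> * fair_opt C F l G k \<alpha> \<beta> + \<epsilon> \<and>
           (\<exists>X. lp_solution C l G \<alpha> \<beta> S \<rho> X) \<and>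
           (\<forall>X. lp_solution C l G \<alpha> \<beta> S \<rho> X \<longrightarrow>
              fair_in_expectation C l G \<alpha> \<beta> S (randomized_assignment C l G S \<rho> X) \<and>
              (\<forall>\<phi> \<in> set_pmf (randomized_assignment C l G S \<rho> X).
                 \<phi> ` C \<subseteq> S \<and> cluster_cost C \<phi> \<le> \<rho>))) \<and>
        (\<exists>\<epsilon>\<^sub>0>0. \<forall>\<epsilon>. 0 < \<epsilon> \<and> \<epsilon> \<le> \<epsilon>\<^sub>0 \<longrightarrow>
           (\<forall>\<rho> X. fair_k_cluster_radius C l G \<alpha> \<beta> \<epsilon> S \<rho> \<and> lp_solution C l G \<alpha> \<beta> S \<rho> X \<longrightarrow>
              (\<forall>\<phi> \<in> set_pmf (randomized_assignment C l G S \<rho> X).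
                 cluster_cost C \<phi> \<le> \<gamma> * fair_opt C F l G k \<alpha> \<beta>)))"
  proof (rule conjI[OF SF conjI[OF card conjI]])
    show "\<exists>\<epsilon>\<^sub>0>0. \<forall>\<epsilon>. 0 < \<epsilon> \<and> \<epsilon> \<le> \<epsilon>\<^sub>0 \<longrightarrow>
           (\<forall>\<rho> X. fair_k_cluster_radius C l G \<alpha> \<beta> \<epsilon> S \<rho> \<and> lp_solution C l G \<alpha> \<beta> S \<rho> X \<longrightarrow>
              (\<forall>\<phi> \<in> set_pmf (randomized_assignment C l G S \<rho> X).
                 cluster_cost C \<phi> \<le> \<gamma> * fair_opt C F l G k \<alpha> \<beta>))"
    proof (rule exI[of _ \<epsilon>\<^sub>0], rule conjI[OF pos], rule allI, rule impI, rule allI, rule allI,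
        rule impI, rule ballI)
      fix \<epsilon> r X \<phi>
      assume "0 < \<epsilon> \<and> \<epsilon> \<le> \<epsilon>\<^sub>0"
        and "fair_k_cluster_radius C l G \<alpha> \<beta> \<epsilon> S r \<and> lp_solution C l G \<alpha> \<beta> S r X"
        and "\<phi> \<in> set_pmf (randomized_assignment C l G S r X)"
      then show "cluster_cost C \<phi> \<le> \<gamma> * fair_opt C F l G k \<alpha> \<beta>"
        by (elim conjE) (rule exact)
    qed
  qed (rule allI, rule impI, rule approx)
qed

section \<open>Moving whole clusters to greedy centers\<close>

lemma dist_le_cluster_cost: "finite C \<Longrightarrow> v \<in> C \<Longrightarrow> dist v (\<phi> v) \<le> cluster_cost C \<phi>"
  by (auto simp: cluster_cost_def)

lemma merge_clusters_general:
  assumes C: "finite C" and S: "greedy_k_center C F k S"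
    and fair: "fair_clustering C F l G k \<alpha> \<beta> T \<phi>"
  shows "\<exists>h. \<forall>v\<in>C. h (\<phi> v) \<in> S \<and> dist v (h (\<phi> v)) \<le> 5 * cluster_cost C \<phi>"
proof -
  let ?L = "cluster_cost C \<phi>"
  have L: "dist v (\<phi> v) \<le> ?L" if "v \<in> C" for v using dist_le_cluster_cost C that by blast
  have \<phi>F: "\<phi> v \<in> F" if "v \<in> C" for v using fair that by (auto simp: fair_clustering_def)
  \<comment> \<open>The point \<open>\<phi> v\<close> of \<open>F\<close> shows that the closest
    point of \<open>F\<close> is within \<open>?L\<close>, so \<open>\<delta>\<close> is
    \<open>?L\<close>.\<close>
  have cover: "\<exists>s\<in>S. dist v s \<le> 2 * ?L + ?L" if "v \<in> C" for v
    using L \<phi>F that by (intro greedy_k_center_dist[OF S fair]) (auto intro: order_trans)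
  have "\<exists>s\<in>S. dist (\<phi> v) s \<le> 4 * ?L" if v: "v \<in> C" for v
  proof -
    obtain s where "s \<in> S" "dist v s \<le> 3 * ?L" using cover[OF v] by auto
    then show ?thesis using L[OF v] dist_triangle3[of "\<phi> v" s v] by (intro bexI[of _ s]) auto
  qed
  \<comment> \<open>The choice is made per cluster center rather than per client.\<close>
  then obtain h where h: "h (\<phi> v) \<in> S" "dist (\<phi> v) (h (\<phi> v)) \<le> 4 * ?L" if "v \<in> C" for v
    using bchoice[of "\<phi> ` C" "\<lambda>f s. s \<in> S \<and> dist f s \<le> 4 * ?L"] by (auto simp: Bex_def)
  have "h (\<phi> v) \<in> S \<and> dist v (h (\<phi> v)) \<le> 5 * ?L" if v: "v \<in> C" for v
    using h[OF v] L[OF v] dist_triangle[of v "h (\<phi> v)" "\<phi> v"] by auto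
  then show ?thesis by blast
qed

lemma merge_clusters_clients:
  assumes C: "finite C" and S: "greedy_k_center C C k S"
    and fair: "fair_clustering C C l G k \<alpha> \<beta> T \<phi>"
  shows "\<exists>h. \<forall>v\<in>C. h (\<phi> v) \<in> S \<and> dist v (h (\<phi> v)) \<le> 3 * cluster_cost C \<phi>"
proof -
  let ?L = "cluster_cost C \<phi>"
  have L: "dist v (\<phi> v) \<le> ?L" if "v \<in> C" for v using dist_le_cluster_cost C that by blast
  have \<phi>C: "\<phi> v \<in> C" if "v \<in> C" for v using fair that by (auto simp: fair_clustering_def)
  \<comment> \<open>A client is its own closest point of \<open>C\<close>, so
    \<open>\<delta>\<close> is 0. The bound will be applied to the client \<open>\<phi> v\<close>,
    which saves the detour through \<open>v\<close>.\<close>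
  have "\<exists>s\<in>S. dist v s \<le> 2 * ?L + 0" if "v \<in> C" for v
    using L that by (intro greedy_k_center_dist[OF S fair]) force+
  then obtain h where h: "h v \<in> S" "dist v (h v) \<le> 2 * ?L" if "v \<in> C" for v
    using bchoice[of C "\<lambda>v s. s \<in> S \<and> dist v s \<le> 2 * ?L"] by (auto simp: Bex_def)
  have "h (\<phi> v) \<in> S \<and> dist v (h (\<phi> v)) \<le> 3 * ?L" if v: "v \<in> C" for v
    using h[OF \<phi>C[OF v]] L[OF v] dist_triangle[of v "h (\<phi> v)" "\<phi> v"] by auto
  then show ?thesis by blast
qed

theorem theorem1:
  fixes C F :: "'a::metric_space set"
    and G :: "nat \<Rightarrow> 'a set"
    and l k :: nat
    and \<alpha> \<beta> :: "nat \<Rightarrow> real"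
  assumes "finite C" and "C \<noteq> {}"
    and "(\<Union>i\<in>{1..l}. G i) = C"
    and "\<And>i. i \<in> {1..l} \<Longrightarrow> \<beta> i \<le> \<alpha> i"
    and "\<exists>S \<phi>. fair_clustering C F l G k \<alpha> \<beta> S \<phi>"
  shows "fair_k_cluster_approximates C F l G k \<alpha> \<beta> 5 \<and>
    (F = C \<longrightarrow> fair_k_cluster_approximates C F l G k \<alpha> \<beta> 3)"
proof (intro conjI impI)
  have G: "G i \<subseteq> C" if "i \<in> {1..l}" for i using assms(3) that by blast
  show "fair_k_cluster_approximates C F l G k \<alpha> \<beta> 5"
    using merge_clusters_general[OF assms(1)]
    by (intro fair_k_cluster_approximates_if_feasible assms G) auto
  assume "F = C"
  then show "fair_k_cluster_approximates C F l G k \<alpha> \<beta> 3"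
    using merge_clusters_clients[OF assms(1)]
    by (intro fair_k_cluster_approximates_if_feasible assms G) auto
qed

end
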